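(* Let $\mathbf{L}$ be either $\mathbf{IL}^-_{\mathrm{seq}}$ or $\mathbf{IL}^-(\mathbf{P})_{\mathrm{seq}}$. Suppose that the sequent $(\Gamma \Rightarrow \Delta)$ has a cut-free proof in $\mathbf{L}$ (a proof not using the rule (cut)). Then for any separation $[(\Gamma_1; \Delta_1), (\Gamma_2; \Delta_2)]$ of $(\Gamma \Rightarrow \Delta)$, there exists a formula $C$ satisfying: 1. $\mathbf{L} \vdash (\Gamma_1 \Rightarrow \Delta_1, C)$ and $\mathbf{L} \vdash (\Gamma_2, C \Rightarrow \Delta_2)$; 2. $\mathrm{var}(C) \subseteq \mathrm{var}(\Gamma_1 \cup \Delta_1) \cap \mathrm{var}(\Gamma_2 \cup \Delta_2)$.
   Context: Formulas are built from propositional variables and $\bot$ with $\neg, \land, \lor, \to$ and a binary modal operator $\rhd$; $\Box A$ abbreviates $(\neg A) \rhd \bot$, and $\Box\Gamma := \{\Box A \mid A \in \Gamma\}$. A sequent is an expression $\Gamma \Rightarrow \Delta$ with $\Gamma, \Delta$ finite sets of formulas; $\Gamma, \Delta$ means $\Gamma \cup \Delta$ and $\Gamma, A$ means $\Gamma \cup \{A\}$. Both systems have the following initial sequents and rules. Initial sequents: $A \Rightarrow A$ and $\bot \Rightarrow$. Logical rules: (wl) from $\Gamma \Rightarrow \Delta$ infer $\Gamma, A \Rightarrow \Delta$; (wr) from $\Gamma \Rightarrow \Delta$ infer $\Gamma \Rightarrow A, \Delta$; ($\neg$l) from $\Gamma \Rightarrow A, \Delta$ infer $\Gamma, \neg A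 \Rightarrow \Delta$; ($\neg$r) from $\Gamma, A \Rightarrow \Delta$ infer $\Gamma \Rightarrow \neg A, \Delta$; ($\land$l) from $\Gamma, A_i \Rightarrow \Delta$ ($i = 1$ or $2$) infer $\Gamma, A_1 \land A_2 \Rightarrow \Delta$; ($\land$r) from $\Gamma \Rightarrow A, \Delta$ and $\Gamma \Rightarrow B, \Delta$ infer $\Gamma \Rightarrow A \land B, \Delta$; ($\lor$l) from $\Gamma, A \Rightarrow \Delta$ and $\Gamma, B \Rightarrow \Delta$ infer $\Gamma, A \lor B \Rightarrow \Delta$; ($\lor$r) from $\Gamma \Rightarrow A_i, \Delta$ ($i=1$ or $2$) infer $\Gamma \Rightarrow A_1 \lor A_2, \Delta$; ($\to$l) from $\Gamma \Rightarrow A, \Delta$ and $\Gamma, B \Rightarrow \Delta$ infer $\Gamma, A \to B \Rightarrow \Delta$; ($\to$r) from $\Gamma, A \Rightarrow B, \Delta$ infer $\Gamma \Rightarrow A \to B, \Delta$. Cut rule: (cut) from $\Gamma \Rightarrow \Delta, A$ and $A, \Sigma \Rightarrow \Pi$ infer $\Gamma, \Sigma \Rightarrow \Delta, \Pi$. $\mathbf{IL}^-_{\mathrm{seq}}$ additionally has two modal rules: ($\Box$) from $\Box\Gamma, \Gamma, \Box A \Rightarrow A$ infer $\Box\Gamma \Rightarrow \Box A$; and ($\rhd$) for $n \geq 0$, from $A \Rightarrow \{X_i \mid i<n\}$ and $Y_i \Rightarrow B$ for all $i<n$, infer $\{X_i \rhd Y_i \mid i<n\} \Rightarrow A \rhd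 B$. $\mathbf{IL}^-(\mathbf{P})_{\mathrm{seq}}$ instead has the single modal rule ($\rhd_{\mathbf{P}}$): for $n \geq 0$ and a (possibly empty) finite set $\Omega$ of formulas of the form $C \rhd D$, from $\Omega, \{X_i \rhd Y_i \mid i<n\}, A \rhd B, A \Rightarrow \{X_i \mid i<n\}$ and $Y_i \Rightarrow B$ for all $i<n$, infer $\Omega, \{X_i \rhd Y_i \mid i < n\} \Rightarrow A \rhd B$. A separation of $(\Gamma \Rightarrow \Delta)$ is a pair $[(\Gamma_1; \Delta_1), (\Gamma_2; \Delta_2)]$ of pairs of finite sets of formulas with $\Gamma_1 \cap \Gamma_2 = \Delta_1 \cap \Delta_2 = \varnothing$, $\Gamma = \Gamma_1 \cup \Gamma_2$ and $\Delta = \Delta_1 \cup \Delta_2$. $\mathrm{var}(A)$ is the set of propositional variables occurring in $A$, and $\mathrm{var}(\Gamma) := \bigcup\{\mathrm{var}(A) \mid A \in \Gamma\}$. *)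

theory Defs
  imports Main
begin

text \<open>The variables are the elements of an arbitrary type; \<open>var\<close> is the set of those occurring in a formula.\<close>

datatype (var: 'v) fm =
    Var 'v
  | Bot  ("\<^bold>\<bottom>")
  | Neg "'v fm"  ("\<^bold>\<not> _" [90] 90)
  | And "'v fm" "'v fm"  (infixr "\<^bold>\<and>" 75)
  | Or "'v fm" "'v fm"  (infixr "\<^bold>\<or>" 70)
  | Imp "'v fm" "'v fm"  (infixr "\<^bold>\<rightarrow>" 65)
  | Rhd "'v fm" "'v fm"  (infix "\<rhd>" 80)

abbreviation Box :: "'v fm \<Rightarrow> 'v fm"  ("\<^bold>\<box> _" [90] 90) where
  "\<^bold>\<box> A \<equiv> (\<^bold>\<not> A) \<rhd> \<^bold>\<bottom>"

definition var_set :: "'v fm set \<Rightarrow> 'v set" where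
  "var_set \<Gamma> = (\<Union>A\<in>\<Gamma>. var A)"

datatype calculus = IL_minus | IL_minus_P

text \<open>\<open>derivable L c \<Gamma> \<Delta>\<close>: the sequent with antecedent \<open>\<Gamma>\<close> and succedent \<open>\<Delta>\<close> has a proof in \<open>L\<close>;
  the rule (cut) may be used in that proof only if \<open>c\<close> is true. Sequents consist of sets, so
  \<open>insert A \<Gamma>\<close> does not exclude \<open>A \<in> \<Gamma>\<close>. Every derivable sequent is finite (\<open>derivable_finite\<close> below).\<close>

inductive derivable :: "calculus \<Rightarrow> bool \<Rightarrow> 'v fm set \<Rightarrow> 'v fm set \<Rightarrow> bool"
  for L :: calculus and c :: bool where
  init: "derivable L c {A} {A}"
| init_bot: "derivable L c {\<^bold>\<bottom>} {}"
| wl: "derivable L c \<Gamma> \<Delta> \<Longrightarrow> derivable L c (insert A \<Gamma>) \<Delta>"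
| wr: "derivable L c \<Gamma> \<Delta> \<Longrightarrow> derivable L c \<Gamma> (insert A \<Delta>)"
| negl: "derivable L c \<Gamma> (insert A \<Delta>) \<Longrightarrow> derivable L c (insert (\<^bold>\<not> A) \<Gamma>) \<Delta>"
| negr: "derivable L c (insert A \<Gamma>) \<Delta> \<Longrightarrow> derivable L c \<Gamma> (insert (\<^bold>\<not> A) \<Delta>)"
| andl1: "derivable L c (insert A \<Gamma>) \<Delta> \<Longrightarrow> derivable L c (insert (A \<^bold>\<and> B) \<Gamma>) \<Delta>"
| andl2: "derivable L c (insert B \<Gamma>) \<Delta> \<Longrightarrow> derivable L c (insert (A \<^bold>\<and> B) \<Gamma>) \<Delta>"
| andr: "derivable L c \<Gamma> (insert A \<Delta>) \<Longrightarrow> derivable L c \<Gamma> (insert B \<Delta>)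
    \<Longrightarrow> derivable L c \<Gamma> (insert (A \<^bold>\<and> B) \<Delta>)"
| orl: "derivable L c (insert A \<Gamma>) \<Delta> \<Longrightarrow> derivable L c (insert B \<Gamma>) \<Delta>
    \<Longrightarrow> derivable L c (insert (A \<^bold>\<or> B) \<Gamma>) \<Delta>"
| orr1: "derivable L c \<Gamma> (insert A \<Delta>) \<Longrightarrow> derivable L c \<Gamma> (insert (A \<^bold>\<or> B) \<Delta>)"
| orr2: "derivable L c \<Gamma> (insert B \<Delta>) \<Longrightarrow> derivable L c \<Gamma> (insert (A \<^bold>\<or> B) \<Delta>)"
| impl: "derivable L c \<Gamma> (insert A \<Delta>) \<Longrightarrow> derivable L c (insert B \<Gamma>) \<Delta>
    \<Longrightarrow> derivable L c (insert (A \<^bold>\<rightarrow> B) \<Gamma>) \<Delta>"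
| impr: "derivable L c (insert A \<Gamma>) (insert B \<Delta>) \<Longrightarrow> derivable L c \<Gamma> (insert (A \<^bold>\<rightarrow> B) \<Delta>)"
| cut: "c \<Longrightarrow> derivable L c \<Gamma> (insert A \<Delta>) \<Longrightarrow> derivable L c (insert A \<Sigma>) \<Pi>
    \<Longrightarrow> derivable L c (\<Gamma> \<union> \<Sigma>) (\<Delta> \<union> \<Pi>)"
| box: "L = IL_minus \<Longrightarrow> finite \<Gamma>
    \<Longrightarrow> derivable L c (Box ` \<Gamma> \<union> \<Gamma> \<union> {\<^bold>\<box> A}) {A}
    \<Longrightarrow> derivable L c (Box ` \<Gamma>) {\<^bold>\<box> A}"
| rhd: "L = IL_minus
    \<Longrightarrow> derivable L c {A} {X i | i. i < (n::nat)}
    \<Longrightarrow> (\<And>i. i < n \<Longrightarrow> derivable L c {Y i} {B})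
    \<Longrightarrow> derivable L c {X i \<rhd> Y i | i. i < n} {A \<rhd> B}"
| rhdP: "L = IL_minus_P \<Longrightarrow> finite \<Omega> \<Longrightarrow> (\<And>F. F \<in> \<Omega> \<Longrightarrow> \<exists>C D. F = C \<rhd> D)
    \<Longrightarrow> derivable L c (\<Omega> \<union> {X i \<rhd> Y i | i. i < (n::nat)} \<union> {A \<rhd> B, A}) {X i | i. i < n}
    \<Longrightarrow> (\<And>i. i < n \<Longrightarrow> derivable L c {Y i} {B})
    \<Longrightarrow> derivable L c (\<Omega> \<union> {X i \<rhd> Y i | i. i < n}) {A \<rhd> B}"

lemma derivable_finite: "derivable L c \<Gamma> \<Delta> \<Longrightarrow> finite \<Gamma> \<and> finite \<Delta>"
  by (induction rule: derivable.induct) auto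

abbreviation provable :: "calculus \<Rightarrow> 'v fm set \<Rightarrow> 'v fm set \<Rightarrow> bool" where
  "provable L \<equiv> derivable L True"

abbreviation cut_free_provable :: "calculus \<Rightarrow> 'v fm set \<Rightarrow> 'v fm set \<Rightarrow> bool" where
  "cut_free_provable L \<equiv> derivable L False"

definition separation ::
  "'v fm set \<Rightarrow> 'v fm set \<Rightarrow> 'v fm set \<times> 'v fm set \<Rightarrow> 'v fm set \<times> 'v fm set \<Rightarrow> bool" where
  "separation \<Gamma> \<Delta> S\<^sub>1 S\<^sub>2 \<longleftrightarrow>
    (case (S\<^sub>1, S\<^sub>2) of ((\<Gamma>\<^sub>1, \<Delta>\<^sub>1), (\<Gamma>\<^sub>2, \<Delta>\<^sub>2)) \<Rightarrow>
      finite \<Gamma>\<^sub>1 \<and> finite \<Delta>\<^sub>1 \<and> finite \<Gamma>\<^sub>2 \<and> finite \<Delta>\<^sub>2 \<and>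
      \<Gamma>\<^sub>1 \<inter> \<Gamma>\<^sub>2 = {} \<and> \<Delta>\<^sub>1 \<inter> \<Delta>\<^sub>2 = {} \<and> \<Gamma> = \<Gamma>\<^sub>1 \<union> \<Gamma>\<^sub>2 \<and> \<Delta> = \<Delta>\<^sub>1 \<union> \<Delta>\<^sub>2)"

end

theory Submission
  imports Defs
begin

text \<open>
  The proof is Maehara's method: an interpolant is built by induction on the cut-free derivation,
  for all ways of dividing the end sequent into two halves at once. Three observations keep the
  case analysis small.

  Halves may overlap and may contain more than the sequent (\<open>splits\<close>). This stronger induction claim
  costs nothing in the construction of interpolants, makes both weakening rules trivial, and spares
  all bookkeeping about a principal formula that also occurs as a side formula.

  If \<open>C\<close> interpolates a division, then \<open>\<^bold>\<not> C\<close> interpolates the division with its halves exchanged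
  (\<open>interpolable_sym\<close>). So the principal formula can always be assumed to lie in the half of
  choice. For a propositional rule acting on the first half, the disjunction of the
  interpolants of the premises works (\<open>interpolable_first_half\<close>).

  For the modal rules put the principal formula \<open>A \<rhd> B\<close> into one half and let \<open>I\<close> be the set of
  those \<open>i\<close> for which \<open>X\<^sub>i \<rhd> Y\<^sub>i\<close> lies in the other half, \<open>J\<close> the set of those for which it lies in
  the same half. Divide the premise \<open>A \<Rightarrow> {X\<^sub>i}\<close> to obtain \<open>C\<close> with \<open>C \<Rightarrow> {X\<^sub>i | i \<in> I}\<close> and \<open>A \<Rightarrow> {X\<^sub>j | j \<in> J}, C\<close>. Divide
  each premise \<open>Y\<^sub>i \<Rightarrow> B\<close> with \<open>i \<in> I\<close> between its two sides to obtain an interpolant, and let \<open>D\<close> be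
  the disjunction of these (\<open>common_interpolant\<close>). Then \<open>C \<rhd> D\<close> interpolates the conclusion: one
  application of the rule derives \<open>C \<rhd> D\<close> from the \<open>X\<^sub>i \<rhd> Y\<^sub>i\<close> with \<open>i \<in> I\<close>, and a second one, in
  which \<open>C \<rhd> D\<close> plays the part of all those \<open>X\<^sub>i \<rhd> Y\<^sub>i\<close>, derives \<open>A \<rhd> B\<close>. The additional antecedent
  formulas in the premise of the rule of \<open>\<^bold>I\<^bold>L\<^sup>-(\<^bold>P)\<close> are simply divided along with the rest. For the
  box rule an interpolant \<open>C\<close> of the premise yields the interpolant \<open>\<^bold>\<box> C\<close>.
\<close>

section \<open>Derivability\<close>

lemma derivable_weaken_left:
  assumes "derivable L c \<Gamma> \<Delta>" "finite \<Sigma>"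
  shows "derivable L c (\<Sigma> \<union> \<Gamma>) \<Delta>"
  using assms(2,1) by (induction \<Sigma>) (auto intro: derivable.wl)

lemma derivable_weaken_right:
  assumes "derivable L c \<Gamma> \<Delta>" "finite \<Pi>"
  shows "derivable L c \<Gamma> (\<Pi> \<union> \<Delta>)"
  using assms(2,1) by (induction \<Pi>) (auto intro: derivable.wr)

lemma derivable_weaken:
  assumes "derivable L c \<Gamma> \<Delta>" "\<Gamma> \<subseteq> \<Gamma>'" "\<Delta> \<subseteq> \<Delta>'" "finite \<Gamma>'" "finite \<Delta>'"
  shows "derivable L c \<Gamma>' \<Delta>'"
  using derivable_weaken_right[OF derivable_weaken_left[OF assms(1,4)] assms(5)] assms(2,3)
  by (simp add: Un_absorb2)

lemma derivable_init: "A \<in> \<Gamma> \<Longrightarrow> A \<in> \<Delta> \<Longrightarrow> finite \<Gamma> \<Longrightarrow> finite \<Delta> \<Longrightarrow> derivable L c \<Gamma> \<Delta>"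
  by (rule derivable_weaken[OF derivable.init]) auto

lemma derivable_bot: "\<^bold>\<bottom> \<in> \<Gamma> \<Longrightarrow> finite \<Gamma> \<Longrightarrow> finite \<Delta> \<Longrightarrow> derivable L c \<Gamma> \<Delta>"
  by (rule derivable_weaken[OF derivable.init_bot]) auto

abbreviation rhds :: "('v fm \<times> 'v fm) set \<Rightarrow> 'v fm set" where
  "rhds P \<equiv> (\<lambda>(X, Y). X \<rhd> Y) ` P"

text \<open>Families indexed by an initial segment of the naturals are awkward to divide in two; sets of
  pairs are not.\<close>

lemma finite_pairs_indexed:
  assumes "finite P"
  obtains X Y and n :: nat
  where "P = {(X i, Y i) | i. i < n}" "fst ` P = {X i | i. i < n}"
    "rhds P = {X i \<rhd> Y i | i. i < n}"
proof -
  obtain n :: nat and f where P: "P = f ` {i. i < n}"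
    using finite_imp_nat_seg_image_inj_on[OF assms] by blast
  show thesis
    by (rule that[of "fst \<circ> f" "snd \<circ> f" n]) (auto simp: P image_image split_beta)
qed

lemma derivable_rhd:
  assumes "finite P" "derivable IL_minus c {A} (fst ` P)"
    and "\<And>X Y. (X, Y) \<in> P \<Longrightarrow> derivable IL_minus c {Y} {B}"
  shows "derivable IL_minus c (rhds P) {A \<rhd> B}"
proof -
  obtain X Y and n :: nat where P: "P = {(X i, Y i) | i. i < n}"
    "fst ` P = {X i | i. i < n}" "rhds P = {X i \<rhd> Y i | i. i < n}"
    using finite_pairs_indexed[OF assms(1)] by blast
  have "derivable IL_minus c {Y i} {B}" if "i < n" for i
    using assms(3)[of "X i" "Y i"] P(1) that by auto
  then show ?thesis
    unfolding P(3) using assms(2) unfolding P(2) by (intro derivable.rhd) auto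
qed

lemma derivable_rhdP:
  assumes "finite P" "finite \<Omega>" "\<And>F. F \<in> \<Omega> \<Longrightarrow> \<exists>C D. F = C \<rhd> D"
    and "derivable IL_minus_P c (\<Omega> \<union> rhds P \<union> {A \<rhd> B, A}) (fst ` P)"
    and "\<And>X Y. (X, Y) \<in> P \<Longrightarrow> derivable IL_minus_P c {Y} {B}"
  shows "derivable IL_minus_P c (\<Omega> \<union> rhds P) {A \<rhd> B}"
proof -
  obtain X Y and n :: nat where P: "P = {(X i, Y i) | i. i < n}"
    "fst ` P = {X i | i. i < n}" "rhds P = {X i \<rhd> Y i | i. i < n}"
    using finite_pairs_indexed[OF assms(1)] by blast
  have "derivable IL_minus_P c {Y i} {B}" if "i < n" for i
    using assms(5)[of "X i" "Y i"] P(1) that by auto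
  then show ?thesis
    unfolding P(3) using assms(2-4) unfolding P(2,3) by (intro derivable.rhdP) auto
qed

section \<open>Interpolants of divided sequents\<close>

definition interpolable ::
  "calculus \<Rightarrow> 'v fm set \<Rightarrow> 'v fm set \<Rightarrow> 'v fm set \<Rightarrow> 'v fm set \<Rightarrow> bool" where
  "interpolable L \<Gamma>\<^sub>1 \<Delta>\<^sub>1 \<Gamma>\<^sub>2 \<Delta>\<^sub>2 \<longleftrightarrow>
    (\<exists>C. provable L \<Gamma>\<^sub>1 (insert C \<Delta>\<^sub>1) \<and> provable L (insert C \<Gamma>\<^sub>2) \<Delta>\<^sub>2 \<and>
      var C \<subseteq> var_set (\<Gamma>\<^sub>1 \<union> \<Delta>\<^sub>1) \<inter> var_set (\<Gamma>\<^sub>2 \<union> \<Delta>\<^sub>2))"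

definition splits :: "calculus \<Rightarrow> 'v fm set \<Rightarrow> 'v fm set \<Rightarrow> bool" where
  "splits L \<Gamma> \<Delta> \<longleftrightarrow>
    (\<forall>\<Gamma>\<^sub>1 \<Delta>\<^sub>1 \<Gamma>\<^sub>2 \<Delta>\<^sub>2. finite \<Gamma>\<^sub>1 \<longrightarrow> finite \<Delta>\<^sub>1 \<longrightarrow> finite \<Gamma>\<^sub>2 \<longrightarrow> finite \<Delta>\<^sub>2 \<longrightarrow>
      \<Gamma> \<subseteq> \<Gamma>\<^sub>1 \<union> \<Gamma>\<^sub>2 \<longrightarrow> \<Delta> \<subseteq> \<Delta>\<^sub>1 \<union> \<Delta>\<^sub>2 \<longrightarrow> interpolable L \<Gamma>\<^sub>1 \<Delta>\<^sub>1 \<Gamma>\<^sub>2 \<Delta>\<^sub>2)"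

lemma var_set_mono: "\<Gamma> \<subseteq> \<Delta> \<Longrightarrow> var_set \<Gamma> \<subseteq> var_set \<Delta>"
  by (auto simp: var_set_def)

lemma var_subset_var_set: "A \<in> \<Gamma> \<Longrightarrow> var A \<subseteq> var_set \<Gamma>"
  by (auto simp: var_set_def)

lemma var_set_simps:
  "var_set {} = {}"
  "var_set (insert A \<Gamma>) = var A \<union> var_set \<Gamma>"
  "var_set (\<Gamma> \<union> \<Delta>) = var_set \<Gamma> \<union> var_set \<Delta>"
  "var_set (rhds P) = var_set (fst ` P) \<union> var_set (snd ` P)"
  by (auto simp: var_set_def split_beta)

lemma interpolableI:
  assumes "provable L \<Gamma>\<^sub>1 (insert C \<Delta>\<^sub>1)" "provable L (insert C \<Gamma>\<^sub>2) \<Delta>\<^sub>2"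
    and "var C \<subseteq> var_set (\<Gamma>\<^sub>1 \<union> \<Delta>\<^sub>1)" "var C \<subseteq> var_set (\<Gamma>\<^sub>2 \<union> \<Delta>\<^sub>2)"
  shows "interpolable L \<Gamma>\<^sub>1 \<Delta>\<^sub>1 \<Gamma>\<^sub>2 \<Delta>\<^sub>2"
  using assms unfolding interpolable_def by blast

lemma interpolable_sym:
  assumes "interpolable L \<Gamma>\<^sub>1 \<Delta>\<^sub>1 \<Gamma>\<^sub>2 \<Delta>\<^sub>2"
  shows "interpolable L \<Gamma>\<^sub>2 \<Delta>\<^sub>2 \<Gamma>\<^sub>1 \<Delta>\<^sub>1"
proof -
  obtain C where "provable L \<Gamma>\<^sub>1 (insert C \<Delta>\<^sub>1)" "provable L (insert C \<Gamma>\<^sub>2) \<Delta>\<^sub>2"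
    "var C \<subseteq> var_set (\<Gamma>\<^sub>1 \<union> \<Delta>\<^sub>1) \<inter> var_set (\<Gamma>\<^sub>2 \<union> \<Delta>\<^sub>2)"
    using assms unfolding interpolable_def by blast
  then show ?thesis
    by (intro interpolableI[of _ _ "\<^bold>\<not> C"]) (auto intro: derivable.negl derivable.negr)
qed

text \<open>The induction step for an arbitrary rule that acts on the first half only and leaves room for
  the interpolant in the succedent. Rules with one premise use it with both premises equal.\<close>

lemma interpolable_first_half:
  assumes "interpolable L \<Gamma>' \<Delta>' \<Gamma>\<^sub>2 \<Delta>\<^sub>2" "interpolable L \<Gamma>'' \<Delta>'' \<Gamma>\<^sub>2 \<Delta>\<^sub>2"
    and rule: "\<And>C. provable L \<Gamma>' (insert C \<Delta>') \<Longrightarrow> provable L \<Gamma>'' (insert C \<Delta>'')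
      \<Longrightarrow> provable L \<Gamma>\<^sub>1 (insert C \<Delta>\<^sub>1)"
    and vars: "var_set (\<Gamma>' \<union> \<Delta>') \<subseteq> var_set (\<Gamma>\<^sub>1 \<union> \<Delta>\<^sub>1)"
      "var_set (\<Gamma>'' \<union> \<Delta>'') \<subseteq> var_set (\<Gamma>\<^sub>1 \<union> \<Delta>\<^sub>1)"
  shows "interpolable L \<Gamma>\<^sub>1 \<Delta>\<^sub>1 \<Gamma>\<^sub>2 \<Delta>\<^sub>2"
proof -
  obtain C where C: "provable L \<Gamma>' (insert C \<Delta>')" "provable L (insert C \<Gamma>\<^sub>2) \<Delta>\<^sub>2"
    "var C \<subseteq> var_set (\<Gamma>' \<union> \<Delta>') \<inter> var_set (\<Gamma>\<^sub>2 \<union> \<Delta>\<^sub>2)"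
    using assms(1) unfolding interpolable_def by blast
  obtain D where D: "provable L \<Gamma>'' (insert D \<Delta>'')" "provable L (insert D \<Gamma>\<^sub>2) \<Delta>\<^sub>2"
    "var D \<subseteq> var_set (\<Gamma>'' \<union> \<Delta>'') \<inter> var_set (\<Gamma>\<^sub>2 \<union> \<Delta>\<^sub>2)"
    using assms(2) unfolding interpolable_def by blast
  have "provable L \<Gamma>\<^sub>1 (insert (C \<^bold>\<or> D) \<Delta>\<^sub>1)"
    using C(1) D(1) by (intro rule) (auto intro: derivable.orr1 derivable.orr2)
  moreover have "provable L (insert (C \<^bold>\<or> D) \<Gamma>\<^sub>2) \<Delta>\<^sub>2"
    using C(2) D(2) by (rule derivable.orl)
  ultimately show ?thesis
    using C(3) D(3) vars by (intro interpolableI[of _ _ "C \<^bold>\<or> D"]) auto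
qed

lemma splitsD:
  assumes "splits L \<Gamma> \<Delta>" "\<Gamma> \<subseteq> \<Gamma>\<^sub>1 \<union> \<Gamma>\<^sub>2" "\<Delta> \<subseteq> \<Delta>\<^sub>1 \<union> \<Delta>\<^sub>2"
    "finite \<Gamma>\<^sub>1" "finite \<Delta>\<^sub>1" "finite \<Gamma>\<^sub>2" "finite \<Delta>\<^sub>2"
  shows "interpolable L \<Gamma>\<^sub>1 \<Delta>\<^sub>1 \<Gamma>\<^sub>2 \<Delta>\<^sub>2"
  using assms unfolding splits_def by blast

lemma splits_mono: "splits L \<Gamma> \<Delta> \<Longrightarrow> \<Gamma> \<subseteq> \<Gamma>' \<Longrightarrow> \<Delta> \<subseteq> \<Delta>' \<Longrightarrow> splits L \<Gamma>' \<Delta>'"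
  unfolding splits_def by (meson subset_trans)

text \<open>Leaving the second half empty and cutting against its interpolant recovers the sequent itself, so
  the statement proved by induction also carries derivability.\<close>

lemma splits_imp_provable:
  assumes "splits L \<Gamma> \<Delta>" "finite \<Gamma>" "finite \<Delta>"
  shows "provable L \<Gamma> \<Delta>"
proof -
  have "interpolable L \<Gamma> \<Delta> {} {}"
    using assms by (intro splitsD[OF assms(1)]) auto
  then obtain C where "provable L \<Gamma> (insert C \<Delta>)" "provable L {C} {}"
    unfolding interpolable_def by blast
  from derivable.cut[OF TrueI this] show ?thesis
    by simp
qed

lemma splits_wlog_left:
  assumes "F \<in> \<Gamma>"
    and "\<And>\<Gamma>\<^sub>1 \<Delta>\<^sub>1 \<Gamma>\<^sub>2 \<Delta>\<^sub>2. F \<in> \<Gamma>\<^sub>1 \<Longrightarrow> \<Gamma> \<subseteq> \<Gamma>\<^sub>1 \<union> \<Gamma>\<^sub>2 \<Longrightarrow> \<Delta> \<subseteq> \<Delta>\<^sub>1 \<union> \<Delta>\<^sub>2 \<Longrightarrow>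
      finite \<Gamma>\<^sub>1 \<Longrightarrow> finite \<Delta>\<^sub>1 \<Longrightarrow> finite \<Gamma>\<^sub>2 \<Longrightarrow> finite \<Delta>\<^sub>2 \<Longrightarrow> interpolable L \<Gamma>\<^sub>1 \<Delta>\<^sub>1 \<Gamma>\<^sub>2 \<Delta>\<^sub>2"
  shows "splits L \<Gamma> \<Delta>"
  unfolding splits_def
proof (intro allI impI)
  fix \<Gamma>\<^sub>1 \<Delta>\<^sub>1 \<Gamma>\<^sub>2 \<Delta>\<^sub>2
  assume fin: "finite \<Gamma>\<^sub>1" "finite \<Delta>\<^sub>1" "finite \<Gamma>\<^sub>2" "finite \<Delta>\<^sub>2"
    and sub: "\<Gamma> \<subseteq> \<Gamma>\<^sub>1 \<union> \<Gamma>\<^sub>2" "\<Delta> \<subseteq> \<Delta>\<^sub>1 \<union> \<Delta>\<^sub>2"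
  show "interpolable L \<Gamma>\<^sub>1 \<Delta>\<^sub>1 \<Gamma>\<^sub>2 \<Delta>\<^sub>2"
  proof (cases "F \<in> \<Gamma>\<^sub>1")
    case True
    then show ?thesis
      using sub fin by (rule assms(2))
  next
    case False
    then show ?thesis
      using assms(1) sub fin by (intro interpolable_sym[OF assms(2)]) auto
  qed
qed

lemma splits_wlog_right:
  assumes "F \<in> \<Delta>"
    and "\<And>\<Gamma>\<^sub>1 \<Delta>\<^sub>1 \<Gamma>\<^sub>2 \<Delta>\<^sub>2. F \<in> \<Delta>\<^sub>1 \<Longrightarrow> \<Gamma> \<subseteq> \<Gamma>\<^sub>1 \<union> \<Gamma>\<^sub>2 \<Longrightarrow> \<Delta> \<subseteq> \<Delta>\<^sub>1 \<union> \<Delta>\<^sub>2 \<Longrightarrow>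
      finite \<Gamma>\<^sub>1 \<Longrightarrow> finite \<Delta>\<^sub>1 \<Longrightarrow> finite \<Gamma>\<^sub>2 \<Longrightarrow> finite \<Delta>\<^sub>2 \<Longrightarrow> interpolable L \<Gamma>\<^sub>1 \<Delta>\<^sub>1 \<Gamma>\<^sub>2 \<Delta>\<^sub>2"
  shows "splits L \<Gamma> \<Delta>"
  unfolding splits_def
proof (intro allI impI)
  fix \<Gamma>\<^sub>1 \<Delta>\<^sub>1 \<Gamma>\<^sub>2 \<Delta>\<^sub>2
  assume fin: "finite \<Gamma>\<^sub>1" "finite \<Delta>\<^sub>1" "finite \<Gamma>\<^sub>2" "finite \<Delta>\<^sub>2"
    and sub: "\<Gamma> \<subseteq> \<Gamma>\<^sub>1 \<union> \<Gamma>\<^sub>2" "\<Delta> \<subseteq> \<Delta>\<^sub>1 \<union> \<Delta>\<^sub>2"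
  show "interpolable L \<Gamma>\<^sub>1 \<Delta>\<^sub>1 \<Gamma>\<^sub>2 \<Delta>\<^sub>2"
  proof (cases "F \<in> \<Delta>\<^sub>1")
    case True
    then show ?thesis
      using sub fin by (rule assms(2))
  next
    case False
    then show ?thesis
      using assms(1) sub fin by (intro interpolable_sym[OF assms(2)]) auto
  qed
qed

section \<open>Propositional rules\<close>

text \<open>In the premises of a propositional rule subformulas \<open>\<Theta>, \<Pi>\<close> (in the second premise \<open>\<Theta>', \<Pi>'\<close>)
  stand in place of the principal formula \<open>F\<close>. They are added to the half containing \<open>F\<close>, which itself
  is kept: its copy of \<open>F\<close> merges with the one that the rule introduces, because sequents are made of sets.\<close>

lemma splits_rule_left:
  assumes "splits L (\<Theta> \<union> \<Gamma>) (\<Pi> \<union> \<Delta>)" "splits L (\<Theta>' \<union> \<Gamma>) (\<Pi>' \<union> \<Delta>)"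
    and fin: "finite \<Theta>" "finite \<Pi>" "finite \<Theta>'" "finite \<Pi>'"
    and vars: "var_set (\<Theta> \<union> \<Pi> \<union> \<Theta>' \<union> \<Pi>') \<subseteq> var F"
    and rule: "\<And>\<Sigma> \<Lambda>. provable L (\<Theta> \<union> \<Sigma>) (\<Pi> \<union> \<Lambda>) \<Longrightarrow> provable L (\<Theta>' \<union> \<Sigma>) (\<Pi>' \<union> \<Lambda>)
      \<Longrightarrow> provable L (insert F \<Sigma>) \<Lambda>"
  shows "splits L (insert F \<Gamma>) \<Delta>"
proof (rule splits_wlog_left[of F])
  fix \<Gamma>\<^sub>1 \<Delta>\<^sub>1 \<Gamma>\<^sub>2 \<Delta>\<^sub>2
  assume F: "F \<in> \<Gamma>\<^sub>1" and sub: "insert F \<Gamma> \<subseteq> \<Gamma>\<^sub>1 \<union> \<Gamma>\<^sub>2" "\<Delta> \<subseteq> \<Delta>\<^sub>1 \<union> \<Delta>\<^sub>2"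
    and fin': "finite \<Gamma>\<^sub>1" "finite \<Delta>\<^sub>1" "finite \<Gamma>\<^sub>2" "finite \<Delta>\<^sub>2"
  have "interpolable L (\<Theta> \<union> \<Gamma>\<^sub>1) (\<Pi> \<union> \<Delta>\<^sub>1) \<Gamma>\<^sub>2 \<Delta>\<^sub>2" "interpolable L (\<Theta>' \<union> \<Gamma>\<^sub>1) (\<Pi>' \<union> \<Delta>\<^sub>1) \<Gamma>\<^sub>2 \<Delta>\<^sub>2"
    using sub fin fin' by (intro splitsD[OF assms(1)] splitsD[OF assms(2)]; auto)+
  then show "interpolable L \<Gamma>\<^sub>1 \<Delta>\<^sub>1 \<Gamma>\<^sub>2 \<Delta>\<^sub>2"
  proof (rule interpolable_first_half)
    show "provable L \<Gamma>\<^sub>1 (insert C \<Delta>\<^sub>1)"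
      if "provable L (\<Theta> \<union> \<Gamma>\<^sub>1) (insert C (\<Pi> \<union> \<Delta>\<^sub>1))" "provable L (\<Theta>' \<union> \<Gamma>\<^sub>1) (insert C (\<Pi>' \<union> \<Delta>\<^sub>1))" for C
      using rule[of \<Gamma>\<^sub>1 "insert C \<Delta>\<^sub>1"] that F by (simp add: insert_absorb)
  qed (use vars F in \<open>auto simp: var_set_def\<close>)
qed simp

lemma splits_rule_right:
  assumes "splits L (\<Theta> \<union> \<Gamma>) (\<Pi> \<union> \<Delta>)" "splits L (\<Theta>' \<union> \<Gamma>) (\<Pi>' \<union> \<Delta>)"
    and fin: "finite \<Theta>" "finite \<Pi>" "finite \<Theta>'" "finite \<Pi>'"
    and vars: "var_set (\<Theta> \<union> \<Pi> \<union> \<Theta>' \<union> \<Pi>') \<subseteq> var F"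
    and rule: "\<And>\<Sigma> \<Lambda>. provable L (\<Theta> \<union> \<Sigma>) (\<Pi> \<union> \<Lambda>) \<Longrightarrow> provable L (\<Theta>' \<union> \<Sigma>) (\<Pi>' \<union> \<Lambda>)
      \<Longrightarrow> provable L \<Sigma> (insert F \<Lambda>)"
  shows "splits L \<Gamma> (insert F \<Delta>)"
proof (rule splits_wlog_right[of F])
  fix \<Gamma>\<^sub>1 \<Delta>\<^sub>1 \<Gamma>\<^sub>2 \<Delta>\<^sub>2
  assume F: "F \<in> \<Delta>\<^sub>1" and sub: "\<Gamma> \<subseteq> \<Gamma>\<^sub>1 \<union> \<Gamma>\<^sub>2" "insert F \<Delta> \<subseteq> \<Delta>\<^sub>1 \<union> \<Delta>\<^sub>2"
    and fin': "finite \<Gamma>\<^sub>1" "finite \<Delta>\<^sub>1" "finite \<Gamma>\<^sub>2" "finite \<Delta>\<^sub>2"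
  have "interpolable L (\<Theta> \<union> \<Gamma>\<^sub>1) (\<Pi> \<union> \<Delta>\<^sub>1) \<Gamma>\<^sub>2 \<Delta>\<^sub>2" "interpolable L (\<Theta>' \<union> \<Gamma>\<^sub>1) (\<Pi>' \<union> \<Delta>\<^sub>1) \<Gamma>\<^sub>2 \<Delta>\<^sub>2"
    using sub fin fin' by (intro splitsD[OF assms(1)] splitsD[OF assms(2)]; auto)+
  then show "interpolable L \<Gamma>\<^sub>1 \<Delta>\<^sub>1 \<Gamma>\<^sub>2 \<Delta>\<^sub>2"
  proof (rule interpolable_first_half)
    show "provable L \<Gamma>\<^sub>1 (insert C \<Delta>\<^sub>1)"
      if "provable L (\<Theta> \<union> \<Gamma>\<^sub>1) (insert C (\<Pi> \<union> \<Delta>\<^sub>1))" "provable L (\<Theta>' \<union> \<Gamma>\<^sub>1) (insert C (\<Pi>' \<union> \<Delta>\<^sub>1))" for C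
      using rule[of \<Gamma>\<^sub>1 "insert C \<Delta>\<^sub>1"] that F by (simp add: insert_absorb)
  qed (use vars F in \<open>auto simp: var_set_def\<close>)
qed simp

text \<open>The interpolant is \<open>A\<close> if it occurs on opposite sides of different halves, and \<open>\<^bold>\<bottom>\<close> if the
  first half is an axiom by itself.\<close>

lemma splits_init: "splits L {A} {A}"
proof (rule splits_wlog_left[of A])
  fix \<Gamma>\<^sub>1 \<Delta>\<^sub>1 \<Gamma>\<^sub>2 \<Delta>\<^sub>2 :: "'a fm set"
  assume A: "A \<in> \<Gamma>\<^sub>1" "{A} \<subseteq> \<Delta>\<^sub>1 \<union> \<Delta>\<^sub>2"
    and fin: "finite \<Gamma>\<^sub>1" "finite \<Delta>\<^sub>1" "finite \<Gamma>\<^sub>2" "finite \<Delta>\<^sub>2"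
  show "interpolable L \<Gamma>\<^sub>1 \<Delta>\<^sub>1 \<Gamma>\<^sub>2 \<Delta>\<^sub>2"
  proof (cases "A \<in> \<Delta>\<^sub>1")
    case True
    then show ?thesis
      using A fin by (intro interpolableI[of _ _ "\<^bold>\<bottom>"]) (auto intro: derivable_init derivable_bot)
  next
    case False
    then show ?thesis
      using A fin var_subset_var_set[of A]
      by (intro interpolableI[of _ _ A]) (auto intro: derivable_init)
  qed
qed simp

lemma splits_bot: "splits L {\<^bold>\<bottom>} {}"
  by (rule splits_wlog_left[of "\<^bold>\<bottom>"])
    (auto intro!: interpolableI[of _ _ "\<^bold>\<bottom>"] derivable_bot)

section \<open>Modal rules\<close>

text \<open>With the principal formula in the first half, the interpolant \<open>C\<close> of the premise is
  proved from the second half \<open>\<^bold>\<box> G\<^sub>2, G\<^sub>2\<close>. Weakening by \<open>\<^bold>\<box> C\<close> turns this, and likewise the sequent using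
  \<open>C\<close>, into a premise of the box rule, where in the latter \<open>C\<close> counts as one more boxed assumption.\<close>

lemma splits_box:
  fixes A :: "'v fm"
  assumes L: "L = IL_minus" and \<Gamma>: "finite \<Gamma>" and prem: "splits L (Box ` \<Gamma> \<union> \<Gamma> \<union> {\<^bold>\<box> A}) {A}"
  shows "splits L (Box ` \<Gamma>) {\<^bold>\<box> A}"
proof (rule splits_wlog_right[of "\<^bold>\<box> A"])
  fix \<Gamma>\<^sub>1 \<Delta>\<^sub>1 \<Gamma>\<^sub>2 \<Delta>\<^sub>2 :: "'v fm set"
  assume A: "\<^bold>\<box> A \<in> \<Delta>\<^sub>1" and sub: "Box ` \<Gamma> \<subseteq> \<Gamma>\<^sub>1 \<union> \<Gamma>\<^sub>2"
    and fin: "finite \<Gamma>\<^sub>1" "finite \<Delta>\<^sub>1" "finite \<Gamma>\<^sub>2" "finite \<Delta>\<^sub>2"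
  define G\<^sub>1 where "G\<^sub>1 = {G \<in> \<Gamma>. \<^bold>\<box> G \<in> \<Gamma>\<^sub>1}"
  define G\<^sub>2 where "G\<^sub>2 = {G \<in> \<Gamma>. \<^bold>\<box> G \<in> \<Gamma>\<^sub>2}"
  have G: "finite G\<^sub>1" "finite G\<^sub>2" "Box ` G\<^sub>1 \<subseteq> \<Gamma>\<^sub>1" "Box ` G\<^sub>2 \<subseteq> \<Gamma>\<^sub>2" "\<Gamma> = G\<^sub>1 \<union> G\<^sub>2"
    using \<Gamma> sub by (auto simp: G\<^sub>1_def G\<^sub>2_def)
  have "interpolable L (Box ` G\<^sub>2 \<union> G\<^sub>2) {} (Box ` G\<^sub>1 \<union> G\<^sub>1 \<union> {\<^bold>\<box> A}) {A}"
    by (rule splitsD[OF prem]) (use G in auto)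
  then obtain C where C: "provable L (Box ` G\<^sub>2 \<union> G\<^sub>2) {C}"
    "provable L (insert C (Box ` G\<^sub>1 \<union> G\<^sub>1 \<union> {\<^bold>\<box> A})) {A}"
    "var C \<subseteq> var_set (Box ` G\<^sub>2 \<union> G\<^sub>2)" "var C \<subseteq> var_set (Box ` G\<^sub>1 \<union> G\<^sub>1 \<union> {\<^bold>\<box> A} \<union> {A})"
    unfolding interpolable_def by auto
  have "provable L (Box ` G\<^sub>2) {\<^bold>\<box> C}"
    by (intro derivable.box L G derivable_weaken[OF C(1)]) (use G in auto)
  then have left: "provable L \<Gamma>\<^sub>2 (insert (\<^bold>\<box> C) \<Delta>\<^sub>2)"
    by (rule derivable_weaken) (use G fin in auto)
  have "provable L (Box ` insert C G\<^sub>1) {\<^bold>\<box> A}"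
    by (intro derivable.box L derivable_weaken[OF C(2)]) (use G in auto)
  then have right: "provable L (insert (\<^bold>\<box> C) \<Gamma>\<^sub>1) \<Delta>\<^sub>1"
    by (rule derivable_weaken) (use A G fin in auto)
  have "var_set (Box ` G\<^sub>2 \<union> G\<^sub>2) \<subseteq> var_set (Box ` G\<^sub>2)"
    "var_set (Box ` G\<^sub>1 \<union> G\<^sub>1 \<union> {\<^bold>\<box> A} \<union> {A}) \<subseteq> var_set (Box ` G\<^sub>1 \<union> {\<^bold>\<box> A})"
    by (auto simp: var_set_def)
  moreover have "var_set (Box ` G\<^sub>2) \<subseteq> var_set (\<Gamma>\<^sub>2 \<union> \<Delta>\<^sub>2)"
    "var_set (Box ` G\<^sub>1 \<union> {\<^bold>\<box> A}) \<subseteq> var_set (\<Gamma>\<^sub>1 \<union> \<Delta>\<^sub>1)"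
    using A G by (intro var_set_mono; auto)+
  ultimately have "interpolable L \<Gamma>\<^sub>2 \<Delta>\<^sub>2 \<Gamma>\<^sub>1 \<Delta>\<^sub>1"
    using C(3,4) by (intro interpolableI[OF left right]) auto
  then show "interpolable L \<Gamma>\<^sub>1 \<Delta>\<^sub>1 \<Gamma>\<^sub>2 \<Delta>\<^sub>2"
    by (rule interpolable_sym)
qed simp

text \<open>Interpolants between several formulas and the same \<open>B\<close> can be merged by taking their disjunction;
  the empty disjunction is \<open>\<^bold>\<bottom>\<close>.\<close>

lemma common_interpolant:
  assumes "finite S" "\<And>Y. Y \<in> S \<Longrightarrow> splits L {Y} {B}"
  obtains D where "\<And>Y. Y \<in> S \<Longrightarrow> provable L {Y} {D}" "provable L {D} {B}"
    "var D \<subseteq> var_set S" "var D \<subseteq> var B"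
proof -
  have "\<exists>D. (\<forall>Y\<in>S. provable L {Y} {D}) \<and> provable L {D} {B} \<and> var D \<subseteq> var_set S \<inter> var B"
    using assms
  proof (induction S)
    case empty
    show ?case
      by (rule exI[of _ "\<^bold>\<bottom>"]) (auto intro: derivable_bot)
  next
    case (insert Y S)
    then obtain D where D: "\<forall>Y\<in>S. provable L {Y} {D}" "provable L {D} {B}"
      "var D \<subseteq> var_set S \<inter> var B"
      by blast
    have "interpolable L {Y} {} {} {B}"
      by (rule splitsD[OF insert.prems[of Y]]) auto
    then obtain E where E: "provable L {Y} {E}" "provable L {E} {B}" "var E \<subseteq> var Y \<inter> var B"
      unfolding interpolable_def by (auto simp: var_set_def)
    have "\<forall>Z\<in>insert Y S. provable L {Z} {E \<^bold>\<or> D}"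
      using D(1) E(1) derivable.orr1[of L True _ E "{}" D] derivable.orr2[of L True _ D "{}" E]
      by auto
    moreover have "provable L {E \<^bold>\<or> D} {B}"
      using D(2) E(2) by (intro derivable.orl)
    ultimately show ?case
      using D(3) E(3) by (intro exI[of _ "E \<^bold>\<or> D"]) (auto simp: var_set_def)
  qed
  then show thesis
    using that by auto
qed

text \<open>The interpolant of the first premise goes to the left of \<open>\<rhd>\<close>. To be usable there it has to prove
  the \<open>X\<close> of the second half and to be an additional case for \<open>A\<close> in the first, so \<open>A\<close> and the
  principal formula belong to the same half of the division.\<close>

lemma splits_rhd:
  fixes A :: "'v fm"
  assumes L: "L = IL_minus" and P: "finite P" and prem: "splits L {A} (fst ` P)"
    and Ys: "\<And>X Y. (X, Y) \<in> P \<Longrightarrow> splits L {Y} {B}"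
  shows "splits L (rhds P) {A \<rhd> B}"
proof (rule splits_wlog_right[of "A \<rhd> B"])
  fix \<Gamma>\<^sub>1 \<Delta>\<^sub>1 \<Gamma>\<^sub>2 \<Delta>\<^sub>2 :: "'v fm set"
  assume A: "A \<rhd> B \<in> \<Delta>\<^sub>1" and sub: "rhds P \<subseteq> \<Gamma>\<^sub>1 \<union> \<Gamma>\<^sub>2"
    and fin: "finite \<Gamma>\<^sub>1" "finite \<Delta>\<^sub>1" "finite \<Gamma>\<^sub>2" "finite \<Delta>\<^sub>2"
  define P\<^sub>1 where "P\<^sub>1 = {p \<in> P. (\<lambda>(X, Y). X \<rhd> Y) p \<in> \<Gamma>\<^sub>1}"
  define P\<^sub>2 where "P\<^sub>2 = {p \<in> P. (\<lambda>(X, Y). X \<rhd> Y) p \<in> \<Gamma>\<^sub>2}"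
  have P12: "finite P\<^sub>1" "finite P\<^sub>2" "P = P\<^sub>1 \<union> P\<^sub>2" "rhds P\<^sub>1 \<subseteq> \<Gamma>\<^sub>1" "rhds P\<^sub>2 \<subseteq> \<Gamma>\<^sub>2"
    using P sub by (auto simp: P\<^sub>1_def P\<^sub>2_def)
  have "interpolable L {A} (fst ` P\<^sub>1) {} (fst ` P\<^sub>2)"
    by (rule splitsD[OF prem]) (use P12 in auto)
  then obtain C where C: "provable L {A} (insert C (fst ` P\<^sub>1))" "provable L {C} (fst ` P\<^sub>2)"
    "var C \<subseteq> var_set ({A} \<union> fst ` P\<^sub>1)" "var C \<subseteq> var_set (fst ` P\<^sub>2)"
    unfolding interpolable_def by auto
  have Ys': "splits L {Y} {B}" if "Y \<in> snd ` P\<^sub>2" for Y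
    using that P12(3) by (auto intro: Ys)
  obtain D where D: "\<And>Y. Y \<in> snd ` P\<^sub>2 \<Longrightarrow> provable L {Y} {D}" "provable L {D} {B}"
    "var D \<subseteq> var_set (snd ` P\<^sub>2)" "var D \<subseteq> var B"
    using common_interpolant[of "snd ` P\<^sub>2" L B] P12(2) Ys' by blast
  have "provable L (rhds P\<^sub>2) {C \<rhd> D}"
    unfolding L by (rule derivable_rhd) (use L P12 C(2) D(1) in force)+
  then have left: "provable L \<Gamma>\<^sub>2 (insert (C \<rhd> D) \<Delta>\<^sub>2)"
    by (rule derivable_weaken) (use P12 fin in auto)
  have Y_B: "provable L {Y} {B}" if "(X, Y) \<in> insert (C, D) P\<^sub>1" for X Y
    using that D(2) P12(3) by (auto intro!: splits_imp_provable Ys[of X])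
  have "provable L (rhds (insert (C, D) P\<^sub>1)) {A \<rhd> B}"
    unfolding L by (rule derivable_rhd) (use L P12 C(1) Y_B in auto)
  then have right: "provable L (insert (C \<rhd> D) \<Gamma>\<^sub>1) \<Delta>\<^sub>1"
    by (rule derivable_weaken) (use A P12 fin in auto)
  have "var (C \<rhd> D) \<subseteq> var_set (rhds P\<^sub>2)"
    using C(4) D(3) by (auto simp: var_set_simps)
  also have "\<dots> \<subseteq> var_set (\<Gamma>\<^sub>2 \<union> \<Delta>\<^sub>2)"
    using P12 by (intro var_set_mono) auto
  finally have var\<^sub>2: "var (C \<rhd> D) \<subseteq> var_set (\<Gamma>\<^sub>2 \<union> \<Delta>\<^sub>2)" .
  have "var (C \<rhd> D) \<subseteq> var_set (rhds P\<^sub>1 \<union> {A \<rhd> B})"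
    using C(3) D(4) by (auto simp: var_set_simps)
  also have "\<dots> \<subseteq> var_set (\<Gamma>\<^sub>1 \<union> \<Delta>\<^sub>1)"
    using A P12 by (intro var_set_mono) auto
  finally have "interpolable L \<Gamma>\<^sub>2 \<Delta>\<^sub>2 \<Gamma>\<^sub>1 \<Delta>\<^sub>1"
    by (rule interpolableI[OF left right var\<^sub>2])
  then show "interpolable L \<Gamma>\<^sub>1 \<Delta>\<^sub>1 \<Gamma>\<^sub>2 \<Delta>\<^sub>2"
    by (rule interpolable_sym)
qed simp

text \<open>The division of the first premise puts \<open>A \<rhd> B\<close> into the same half as \<open>A\<close>, where the second
  application of the rule wants it. Both applications also want \<open>C \<rhd> D\<close> in the antecedent of their first
  premise, the first one as the formula being introduced and the second one as a formula being used;
  weakening supplies it.\<close>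

lemma splits_rhdP:
  fixes A :: "'v fm"
  assumes L: "L = IL_minus_P" and P: "finite P"
    and \<Omega>: "finite \<Omega>" "\<And>F. F \<in> \<Omega> \<Longrightarrow> \<exists>C D. F = C \<rhd> D"
    and prem: "splits L (\<Omega> \<union> rhds P \<union> {A \<rhd> B, A}) (fst ` P)"
    and Ys: "\<And>X Y. (X, Y) \<in> P \<Longrightarrow> splits L {Y} {B}"
  shows "splits L (\<Omega> \<union> rhds P) {A \<rhd> B}"
proof (rule splits_wlog_right[of "A \<rhd> B"])
  fix \<Gamma>\<^sub>1 \<Delta>\<^sub>1 \<Gamma>\<^sub>2 \<Delta>\<^sub>2 :: "'v fm set"
  assume A: "A \<rhd> B \<in> \<Delta>\<^sub>1" and sub: "\<Omega> \<union> rhds P \<subseteq> \<Gamma>\<^sub>1 \<union> \<Gamma>\<^sub>2"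
    and fin: "finite \<Gamma>\<^sub>1" "finite \<Delta>\<^sub>1" "finite \<Gamma>\<^sub>2" "finite \<Delta>\<^sub>2"
  define P\<^sub>1 where "P\<^sub>1 = {p \<in> P. (\<lambda>(X, Y). X \<rhd> Y) p \<in> \<Gamma>\<^sub>1}"
  define P\<^sub>2 where "P\<^sub>2 = {p \<in> P. (\<lambda>(X, Y). X \<rhd> Y) p \<in> \<Gamma>\<^sub>2}"
  define \<Omega>\<^sub>1 where "\<Omega>\<^sub>1 = \<Omega> \<inter> \<Gamma>\<^sub>1"
  define \<Omega>\<^sub>2 where "\<Omega>\<^sub>2 = \<Omega> \<inter> \<Gamma>\<^sub>2"
  have P12: "finite P\<^sub>1" "finite P\<^sub>2" "P = P\<^sub>1 \<union> P\<^sub>2" "rhds P\<^sub>1 \<subseteq> \<Gamma>\<^sub>1" "rhds P\<^sub>2 \<subseteq> \<Gamma>\<^sub>2"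
    using P sub by (auto simp: P\<^sub>1_def P\<^sub>2_def)
  have \<Omega>12: "finite \<Omega>\<^sub>1" "finite \<Omega>\<^sub>2" "\<Omega> = \<Omega>\<^sub>1 \<union> \<Omega>\<^sub>2" "\<Omega>\<^sub>1 \<subseteq> \<Gamma>\<^sub>1" "\<Omega>\<^sub>2 \<subseteq> \<Gamma>\<^sub>2"
    using \<Omega>(1) sub by (auto simp: \<Omega>\<^sub>1_def \<Omega>\<^sub>2_def)
  have "interpolable L (\<Omega>\<^sub>1 \<union> rhds P\<^sub>1 \<union> {A \<rhd> B, A}) (fst ` P\<^sub>1) (\<Omega>\<^sub>2 \<union> rhds P\<^sub>2) (fst ` P\<^sub>2)"
    by (rule splitsD[OF prem]) (use P12 \<Omega>12 in auto)
  then obtain C where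
    C: "provable L (\<Omega>\<^sub>1 \<union> rhds P\<^sub>1 \<union> {A \<rhd> B, A}) (insert C (fst ` P\<^sub>1))"
      "provable L (insert C (\<Omega>\<^sub>2 \<union> rhds P\<^sub>2)) (fst ` P\<^sub>2)"
      "var C \<subseteq> var_set (\<Omega>\<^sub>1 \<union> rhds P\<^sub>1 \<union> {A \<rhd> B, A} \<union> fst ` P\<^sub>1)"
      "var C \<subseteq> var_set (\<Omega>\<^sub>2 \<union> rhds P\<^sub>2 \<union> fst ` P\<^sub>2)"
    unfolding interpolable_def by blast
  have Ys': "splits L {Y} {B}" if "Y \<in> snd ` P\<^sub>2" for Y
    using that P12(3) by (auto intro: Ys)
  obtain D where D: "\<And>Y. Y \<in> snd ` P\<^sub>2 \<Longrightarrow> provable L {Y} {D}" "provable L {D} {B}"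
    "var D \<subseteq> var_set (snd ` P\<^sub>2)" "var D \<subseteq> var B"
    using common_interpolant[of "snd ` P\<^sub>2" L B] P12(2) Ys' by blast
  have "provable L (\<Omega>\<^sub>2 \<union> rhds P\<^sub>2 \<union> {C \<rhd> D, C}) (fst ` P\<^sub>2)"
    by (rule derivable_weaken[OF C(2)]) (use P12 \<Omega>12 in auto)
  then have "provable L (\<Omega>\<^sub>2 \<union> rhds P\<^sub>2) {C \<rhd> D}"
    using P12(2) \<Omega>12(2) unfolding L
  proof (intro derivable_rhdP)
    show "\<exists>C D. F = C \<rhd> D" if "F \<in> \<Omega>\<^sub>2" for F
      using that \<Omega>(2) \<Omega>12(3) by blast
    show "provable IL_minus_P {Y} {D}" if "(X, Y) \<in> P\<^sub>2" for X Y
      using that D(1) L by force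
  qed
  then have left: "provable L \<Gamma>\<^sub>2 (insert (C \<rhd> D) \<Delta>\<^sub>2)"
    by (rule derivable_weaken) (use P12 \<Omega>12 fin in auto)
  have "provable L (\<Omega>\<^sub>1 \<union> rhds (insert (C, D) P\<^sub>1) \<union> {A \<rhd> B, A}) (fst ` insert (C, D) P\<^sub>1)"
    by (rule derivable_weaken[OF C(1)]) (use P12 \<Omega>12 in auto)
  then have "provable L (\<Omega>\<^sub>1 \<union> rhds (insert (C, D) P\<^sub>1)) {A \<rhd> B}"
    using P12(1) \<Omega>12(1) unfolding L
  proof (intro derivable_rhdP)
    show "\<exists>C D. F = C \<rhd> D" if "F \<in> \<Omega>\<^sub>1" for F
      using that \<Omega>(2) \<Omega>12(3) by blast
    show "provable IL_minus_P {Y} {B}" if "(X, Y) \<in> insert (C, D) P\<^sub>1" for X Y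
      using that D(2) P12(3) L by (auto intro!: splits_imp_provable Ys[of X, unfolded L])
  qed auto
  then have right: "provable L (insert (C \<rhd> D) \<Gamma>\<^sub>1) \<Delta>\<^sub>1"
    by (rule derivable_weaken) (use A P12 \<Omega>12 fin in auto)
  have "var (C \<rhd> D) \<subseteq> var_set (\<Omega>\<^sub>2 \<union> rhds P\<^sub>2)"
    using C(4) D(3) by (auto simp: var_set_simps)
  also have "\<dots> \<subseteq> var_set (\<Gamma>\<^sub>2 \<union> \<Delta>\<^sub>2)"
    using P12 \<Omega>12 by (intro var_set_mono) auto
  finally have var\<^sub>2: "var (C \<rhd> D) \<subseteq> var_set (\<Gamma>\<^sub>2 \<union> \<Delta>\<^sub>2)" .
  have "var (C \<rhd> D) \<subseteq> var_set (\<Omega>\<^sub>1 \<union> rhds P\<^sub>1 \<union> {A \<rhd> B})"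
    using C(3) D(4) by (auto simp: var_set_simps)
  also have "\<dots> \<subseteq> var_set (\<Gamma>\<^sub>1 \<union> \<Delta>\<^sub>1)"
    using A P12 \<Omega>12 by (intro var_set_mono) auto
  finally have "interpolable L \<Gamma>\<^sub>2 \<Delta>\<^sub>2 \<Gamma>\<^sub>1 \<Delta>\<^sub>1"
    by (rule interpolableI[OF left right var\<^sub>2])
  then show "interpolable L \<Gamma>\<^sub>1 \<Delta>\<^sub>1 \<Gamma>\<^sub>2 \<Delta>\<^sub>2"
    by (rule interpolable_sym)
qed simp

section \<open>Interpolation\<close>

lemma cut_free_splits:
  assumes "cut_free_provable L \<Gamma> \<Delta>"
  shows "splits L \<Gamma> \<Delta>"
  using assms
proof (induction rule: derivable.induct)
  case (init A)
  show ?case by (rule splits_init)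
next
  case init_bot
  show ?case by (rule splits_bot)
next
  case (wl \<Gamma> \<Delta> A)
  then show ?case by (blast intro: splits_mono)
next
  case (wr \<Gamma> \<Delta> A)
  then show ?case by (blast intro: splits_mono)
next
  case (negl \<Gamma> A \<Delta>)
  show ?case
    by (rule splits_rule_left[of L "{}" _ "{A}" _ "{}" "{A}"])
      (use negl in \<open>auto simp: var_set_def intro: derivable.negl\<close>)
next
  case (negr A \<Gamma> \<Delta>)
  show ?case
    by (rule splits_rule_right[of L "{A}" _ "{}" _ "{A}" "{}"])
      (use negr in \<open>auto simp: var_set_def intro: derivable.negr\<close>)
next
  case (andl1 A \<Gamma> \<Delta> B)
  show ?case
    by (rule splits_rule_left[of L "{A}" _ "{}" _ "{A}" "{}"])
      (use andl1 in \<open>auto simp: var_set_def intro: derivable.andl1\<close>)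
next
  case (andl2 B \<Gamma> \<Delta> A)
  show ?case
    by (rule splits_rule_left[of L "{B}" _ "{}" _ "{B}" "{}"])
      (use andl2 in \<open>auto simp: var_set_def intro: derivable.andl2\<close>)
next
  case (andr \<Gamma> A \<Delta> B)
  show ?case
    by (rule splits_rule_right[of L "{}" _ "{A}" _ "{}" "{B}"])
      (use andr in \<open>auto simp: var_set_def intro: derivable.andr\<close>)
next
  case (orl A \<Gamma> \<Delta> B)
  show ?case
    by (rule splits_rule_left[of L "{A}" _ "{}" _ "{B}" "{}"])
      (use orl in \<open>auto simp: var_set_def intro: derivable.orl\<close>)
next
  case (orr1 \<Gamma> A \<Delta> B)
  show ?case
    by (rule splits_rule_right[of L "{}" _ "{A}" _ "{}" "{A}"])
      (use orr1 in \<open>auto simp: var_set_def intro: derivable.orr1\<close>)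
next
  case (orr2 \<Gamma> B \<Delta> A)
  show ?case
    by (rule splits_rule_right[of L "{}" _ "{B}" _ "{}" "{B}"])
      (use orr2 in \<open>auto simp: var_set_def intro: derivable.orr2\<close>)
next
  case (impl \<Gamma> A \<Delta> B)
  show ?case
    by (rule splits_rule_left[of L "{}" _ "{A}" _ "{B}" "{}"])
      (use impl in \<open>auto simp: var_set_def intro: derivable.impl\<close>)
next
  case (impr A \<Gamma> B \<Delta>)
  show ?case
    by (rule splits_rule_right[of L "{A}" _ "{B}" _ "{A}" "{B}"])
      (use impr in \<open>auto simp: var_set_def intro: derivable.impr\<close>)
next
  case (cut \<Gamma> A \<Delta> \<Sigma> \<Pi>)
  then show ?case by simp
next
  case (box \<Gamma> A)
  then show ?case by (intro splits_box)
next
  case (rhd A X n Y B)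
  let ?P = "{(X i, Y i) | i. i < n}"
  have eq: "fst ` ?P = {X i | i. i < n}" "rhds ?P = {X i \<rhd> Y i | i. i < n}"
    by force+
  have "splits L (rhds ?P) {A \<rhd> B}"
    by (rule splits_rhd) (use rhd eq in auto)
  then show ?case
    unfolding eq .
next
  case (rhdP \<Omega> X Y n A B)
  let ?P = "{(X i, Y i) | i. i < n}"
  have eq: "fst ` ?P = {X i | i. i < n}" "rhds ?P = {X i \<rhd> Y i | i. i < n}"
    by force+
  have "splits L (\<Omega> \<union> rhds ?P) {A \<rhd> B}"
    by (rule splits_rhdP) (use rhdP eq in auto)
  then show ?case
    unfolding eq .
qed

theorem theorem3p8:
  fixes L :: calculus and \<Gamma> \<Delta> \<Gamma>\<^sub>1 \<Delta>\<^sub>1 \<Gamma>\<^sub>2 \<Delta>\<^sub>2 :: "'v fm set"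
  assumes "cut_free_provable L \<Gamma> \<Delta>"
    and "separation \<Gamma> \<Delta> (\<Gamma>\<^sub>1, \<Delta>\<^sub>1) (\<Gamma>\<^sub>2, \<Delta>\<^sub>2)"
  shows "\<exists>C :: 'v fm.
    (provable L \<Gamma>\<^sub>1 (\<Delta>\<^sub>1 \<union> {C}) \<and> provable L (\<Gamma>\<^sub>2 \<union> {C}) \<Delta>\<^sub>2) \<and>
    var C \<subseteq> var_set (\<Gamma>\<^sub>1 \<union> \<Delta>\<^sub>1) \<inter> var_set (\<Gamma>\<^sub>2 \<union> \<Delta>\<^sub>2)"
proof -
  have "interpolable L \<Gamma>\<^sub>1 \<Delta>\<^sub>1 \<Gamma>\<^sub>2 \<Delta>\<^sub>2"
    using assms(2) by (intro splitsD[OF cut_free_splits[OF assms(1)]]) (auto simp: separation_def)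
  then show ?thesis
    unfolding interpolable_def by auto
qed

end
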